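(* For every positive integer $n$ with $4 \mid n$, $$t^3_2(n, K_4^3 - e) \ge n/2 - 1.$$
   Context: A 3-graph $H$ is a pair $(V(H),E(H))$ where $V(H)$ is a finite set of vertices and $E(H)$ is a set of 3-element subsets of $V(H)$; its order is $|V(H)|$. For a 2-set $T$ of vertices, $\deg(T)$ is the number of vertices $v$ such that $T\cup\{v\}$ is an edge of $H$, and $\delta_2(H)$ is the minimum of $\deg(T)$ over all 2-element subsets $T$ of $V(H)$. $K_4^3-e$ denotes the 3-graph on 4 vertices with exactly 3 edges. For a 3-graph $F$, an $F$-factor in $H$ is a spanning subgraph of $H$ consisting of vertex-disjoint copies of $F$ (copies are not required to be induced). For $n$ divisible by $|V(F)|$, $t^3_2(n,F)$ is the smallest integer $d$ such that every 3-graph $H$ of order $n$ with $\delta_2(H)\ge d$ contains an $F$-factor. *)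

theory Defs
  imports Complex_Main
begin

type_synonym 'a hypergraph = "'a set \<times> 'a set set"

abbreviation verts :: "'a hypergraph \<Rightarrow> 'a set" where
  "verts H \<equiv> fst H"

abbreviation edges :: "'a hypergraph \<Rightarrow> 'a set set" where
  "edges H \<equiv> snd H"

definition three_graph :: "'a hypergraph \<Rightarrow> bool" where
  "three_graph H \<longleftrightarrow> finite (verts H) \<and> (\<forall>e\<in>edges H. e \<subseteq> verts H \<and> card e = 3)"

definition codeg :: "'a hypergraph \<Rightarrow> 'a set \<Rightarrow> nat" where
  "codeg H T = card {v \<in> verts H. T \<union> {v} \<in> edges H}"

(* Only meaningful for 3-graphs of order at least 2; otherwise the minimum is over the empty set. *)
definition min_codeg :: "'a hypergraph \<Rightarrow> nat" where
  "min_codeg H = Min (codeg H ` {T. T \<subseteq> verts H \<and> card T = 2})"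

definition subgraph_of :: "'a hypergraph \<Rightarrow> 'a hypergraph \<Rightarrow> bool" where
  "subgraph_of G H \<longleftrightarrow> three_graph G \<and> verts G \<subseteq> verts H \<and> edges G \<subseteq> edges H"

definition isomorphic :: "'a hypergraph \<Rightarrow> 'b hypergraph \<Rightarrow> bool" where
  "isomorphic F G \<longleftrightarrow> (\<exists>f. bij_betw f (verts F) (verts G) \<and> edges G = (\<lambda>e. f ` e) ` edges F)"

definition is_factor :: "'b hypergraph \<Rightarrow> 'a hypergraph \<Rightarrow> 'a hypergraph \<Rightarrow> bool" where
  "is_factor F H G \<longleftrightarrow> subgraph_of G H \<and> verts G = verts H \<and>
    (\<exists>\<C>. (\<forall>C\<in>\<C>. isomorphic F C) \<and>
         (\<forall>C\<in>\<C>. \<forall>D\<in>\<C>. C \<noteq> D \<longrightarrow> verts C \<inter> verts D = {}) \<and>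
         verts G = (\<Union>C\<in>\<C>. verts C) \<and> edges G = (\<Union>C\<in>\<C>. edges C))"

definition has_factor :: "'b hypergraph \<Rightarrow> 'a hypergraph \<Rightarrow> bool" where
  "has_factor F H \<longleftrightarrow> (\<exists>G. is_factor F H G)"

(* The host 3-graphs have natural numbers as vertices, which covers all finite 3-graphs up to
   isomorphism.  For n at least 2 some d always qualifies (min_codeg H \<ge> n + 1 is impossible),
   so LEAST is an attained minimum; a negative d would impose the same condition as d = 0. *)
definition factor_threshold :: "nat \<Rightarrow> 'b hypergraph \<Rightarrow> nat" where
  "factor_threshold n F =
    (LEAST d. \<forall>H :: nat hypergraph.
       three_graph H \<and> card (verts H) = n \<and> min_codeg H \<ge> d \<longrightarrow> has_factor F H)"

definition K4_minus_e :: "nat hypergraph" where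
  "K4_minus_e = ({0, 1, 2, 3}, {{0, 1, 2}, {0, 1, 3}, {0, 2, 3}})"

end

theory Submission imports Defs begin

text \<open>
  Fix a set \<open>A\<close> of vertices and take as edges all triples that meet \<open>A\<close> in an odd number of
  vertices. A 4-set spans at least three edges only if it meets \<open>A\<close> in one or in four vertices,
  so every copy of \<open>K\<^sub>4 - e\<close> meets \<open>A\<close> in a number of vertices congruent to 1 modulo 3, and a factor
  on \<open>4 * k\<close> vertices forces \<open>card A\<close> to be congruent to \<open>k\<close> modulo 3. Both \<open>card A = 2 * k\<close> and
  \<open>card A = 2 * k + 1\<close> give minimum codegree at least \<open>2 * k - 2\<close>, and at least one of them
  violates the congruence.
\<close>

definition parity_graph :: "'a set \<Rightarrow> 'a set \<Rightarrow> 'a hypergraph" where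
  "parity_graph V A = (V, {e. e \<subseteq> V \<and> card e = 3 \<and> odd (card (e \<inter> A))})"

lemma verts_parity_graph [simp]: "verts (parity_graph V A) = V"
  by (simp add: parity_graph_def)

lemma edges_parity_graph:
  "e \<in> edges (parity_graph V A) \<longleftrightarrow> e \<subseteq> V \<and> card e = 3 \<and> odd (card (e \<inter> A))"
  by (simp add: parity_graph_def)

lemma three_graph_parity_graph: "finite V \<Longrightarrow> three_graph (parity_graph V A)"
  by (simp add: three_graph_def edges_parity_graph)

text \<open>Here \<open>w\<close>, the image of 0, is the vertex common to all three edges.\<close>

lemma isomorphic_K4_minus_eE:
  assumes "isomorphic K4_minus_e C"
  obtains w x y z where "distinct [w, x, y, z]" "verts C = {w, x, y, z}"
    "edges C = {{w, x, y}, {w, x, z}, {w, y, z}}"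
proof -
  obtain f where f: "bij_betw f {0, 1, 2, 3 :: nat} (verts C)"
    and e: "edges C = (\<lambda>e. f ` e) ` {{0, 1, 2}, {0, 1, 3}, {0, 2, 3}}"
    using assms by (auto simp: isomorphic_def K4_minus_e_def)
  have "inj_on f {0, 1, 2, 3}" and v: "verts C = f ` {0, 1, 2, 3}"
    using f by (auto simp: bij_betw_def)
  then have "distinct [f 0, f 1, f 2, f 3]"
    by (auto simp: inj_on_def)
  with v e show thesis
    by (intro that[of "f 0" "f 1" "f 2" "f 3"]) simp_all
qed

text \<open>If \<open>w\<close> lies in \<open>A\<close>, each pair from \<open>x\<close>,
  \<open>y\<close>, \<open>z\<close> meets \<open>A\<close> in an even number of vertices, so all
  three lie in \<open>A\<close> or none does, giving 4 or 1 in total. If \<open>w\<close> lies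
  outside \<open>A\<close>, each pair would contain exactly one vertex of \<open>A\<close>, which is
  impossible for three vertices.\<close>

lemma K4_minus_e_in_parity_graph:
  assumes "isomorphic K4_minus_e C" and "edges C \<subseteq> edges (parity_graph V A)"
  shows "card (verts C) = 4" and "card (verts C \<inter> A) mod 3 = 1"
proof -
  from assms(1) obtain w x y z where d: "distinct [w, x, y, z]"
    and v: "verts C = {w, x, y, z}"
    and e: "edges C = {{w, x, y}, {w, x, z}, {w, y, z}}"
    by (rule isomorphic_K4_minus_eE)
  show "card (verts C) = 4"
    using d v by simp
  have "odd (card ({w, x, y} \<inter> A))" "odd (card ({w, x, z} \<inter> A))" "odd (card ({w, y, z} \<inter> A))"
    using assms(2) e by (auto simp: edges_parity_graph)
  then show "card (verts C \<inter> A) mod 3 = 1"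
    using d unfolding v
    by (cases "w \<in> A"; cases "x \<in> A"; cases "y \<in> A"; cases "z \<in> A") simp_all
qed

text \<open>The witness \<open>k\<close> is the number of copies in the factor.\<close>

lemma parity_graph_factor_imp_cong:
  assumes "finite V" "A \<subseteq> V" "has_factor K4_minus_e (parity_graph V A)"
  obtains k where "card V = 4 * k" "card A mod 3 = k mod 3"
proof -
  obtain G where "is_factor K4_minus_e (parity_graph V A) G"
    using assms(3) by (auto simp: has_factor_def)
  then have G: "edges G \<subseteq> edges (parity_graph V A)" "verts G = V"
    and "\<exists>\<C>. (\<forall>C\<in>\<C>. isomorphic K4_minus_e C) \<and>
         (\<forall>C\<in>\<C>. \<forall>D\<in>\<C>. C \<noteq> D \<longrightarrow> verts C \<inter> verts D = {}) \<and>
         verts G = (\<Union>C\<in>\<C>. verts C) \<and> edges G = (\<Union>C\<in>\<C>. edges C)"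
    unfolding is_factor_def subgraph_of_def verts_parity_graph by - (elim conjE, assumption)+
  then obtain \<C> where iso: "\<And>C. C \<in> \<C> \<Longrightarrow> isomorphic K4_minus_e C"
    and disj: "\<And>C D. C \<in> \<C> \<Longrightarrow> D \<in> \<C> \<Longrightarrow> C \<noteq> D \<Longrightarrow> verts C \<inter> verts D = {}"
    and vG: "verts G = (\<Union>C\<in>\<C>. verts C)" and eG: "edges G = (\<Union>C\<in>\<C>. edges C)"
    by metis
  have "edges C \<subseteq> edges (parity_graph V A)" if "C \<in> \<C>" for C
    using that G(1) eG by blast
  note copy = K4_minus_e_in_parity_graph[OF iso this]
  \<comment> \<open>Counting over vertex sets instead of copies gives finiteness at once, since the
    union of \<open>\<V>\<close> is the finite set \<open>V\<close>. Different vertex sets come from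
    different copies, so disjointness carries over.\<close>
  define \<V> where "\<V> = verts ` \<C>"
  have V: "\<Union>\<V> = V"
    using vG G(2) by (simp add: \<V>_def)
  have fin: "finite \<V>"
    using V assms(1) finite_UnionD by blast
  have fin': "finite S" if "S \<in> \<V>" for S
    using that V assms(1) by (meson Union_upper finite_subset)
  have dis: "S \<inter> T = {}" if ST: "S \<in> \<V>" "T \<in> \<V>" "S \<noteq> T" for S T
  proof -
    obtain C D where CD: "C \<in> \<C>" "S = verts C" "D \<in> \<C>" "T = verts D"
      using ST(1,2) unfolding \<V>_def by blast
    then have "C \<noteq> D"
      using ST(3) by blast
    then show ?thesis
      using disj[of C D] CD by simp
  qed
  have \<V>: "card S = 4" "card (S \<inter> A) mod 3 = 1" if "S \<in> \<V>" for S
    using that copy unfolding \<V>_def by blast+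
  have "card V = (\<Sum>S\<in>\<V>. card S)"
    unfolding V[symmetric]
    by (intro card_Union_disjoint) (simp_all add: pairwise_def disjnt_def fin' dis)
  also have "\<dots> = 4 * card \<V>"
    by (simp add: \<V>(1))
  finally have "card V = 4 * card \<V>" .
  moreover have "card A = (\<Sum>S\<in>\<V>. card (S \<inter> A))"
  proof -
    have "A = (\<Union>S\<in>\<V>. S \<inter> A)"
      using V assms(2) by auto
    moreover have "card (\<Union>S\<in>\<V>. S \<inter> A) = (\<Sum>S\<in>\<V>. card (S \<inter> A))"
    proof (intro card_UN_disjoint ballI impI)
      show "(S \<inter> A) \<inter> (T \<inter> A) = {}" if "S \<in> \<V>" "T \<in> \<V>" "S \<noteq> T" for S T
        using dis[OF that] by blast
    qed (simp_all add: fin fin')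
    ultimately show ?thesis by simp
  qed
  \<comment> \<open>Reduced mod 3, every summand becomes 1, so the sum just counts the
    copies.\<close>
  then have "card A mod 3 = (\<Sum>S\<in>\<V>. card (S \<inter> A) mod 3) mod 3"
    by (simp add: mod_sum_eq)
  then have "card A mod 3 = card \<V> mod 3"
    by (simp add: \<V>(2))
  ultimately show thesis
    by (rule that)
qed

lemma codeg_le_card_verts: "finite (verts H) \<Longrightarrow> codeg H T \<le> card (verts H)"
  unfolding codeg_def by (rule card_mono) auto

text \<open>Two vertices are required so that \<open>Min\<close> ranges over a nonempty set.\<close>

lemma le_min_codeg_iff:
  assumes "finite (verts H)" "2 \<le> card (verts H)"
  shows "d \<le> min_codeg H \<longleftrightarrow> (\<forall>T. T \<subseteq> verts H \<and> card T = 2 \<longrightarrow> d \<le> codeg H T)"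
proof -
  have "\<exists>T. T \<subseteq> verts H \<and> card T = 2"
    using obtain_subset_with_card_n[OF assms(2)] by metis
  then show ?thesis
    using assms(1) unfolding min_codeg_def by (subst Min_ge_iff) auto
qed

lemma min_codeg_le_card_verts:
  assumes "finite (verts H)" "2 \<le> card (verts H)"
  shows "min_codeg H \<le> card (verts H)"
proof -
  obtain T where "T \<subseteq> verts H" "card T = 2"
    using obtain_subset_with_card_n[OF assms(2)] by metis
  then have "min_codeg H \<le> codeg H T"
    using le_min_codeg_iff[OF assms] by blast
  then show ?thesis
    using codeg_le_card_verts[OF assms(1)] le_trans by blast
qed

text \<open>A pair inside \<open>A\<close> is completed to an edge by the other
  \<open>card A - 2\<close> vertices of \<open>A\<close>, a pair outside \<open>A\<close> by every
  vertex of \<open>A\<close>, and a mixed pair by the other \<open>card (V - A) - 1\<close> vertices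
  outside \<open>A\<close>.\<close>

lemma min_codeg_parity_graph:
  assumes "finite V" "A \<subseteq> V" "2 \<le> card V" "d + 2 \<le> card A" "d + 1 \<le> card (V - A)"
  shows "d \<le> min_codeg (parity_graph V A)"
proof -
  have "d \<le> codeg (parity_graph V A) T" if T: "T \<subseteq> V" "card T = 2" for T
  proof -
    obtain x y where xy: "T = {x, y}" "x \<noteq> y" "x \<in> V" "y \<in> V"
      using T by (auto simp: card_2_iff)
    \<comment> \<open>The condition \<open>v \<notin> T\<close> ensures that
      \<open>insert v T\<close> has three elements.\<close>
    have bound: "card S \<le> codeg (parity_graph V A) T"
      if "S \<subseteq> V" "\<And>v. v \<in> S \<Longrightarrow> v \<notin> T \<and> odd (card (insert v T \<inter> A))" for S
      unfolding codeg_def using that assms(1) T finite_subset[OF T(1)]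
      by (intro card_mono) (auto simp: edges_parity_graph)
    have "finite A"
      using assms(1,2) finite_subset by blast
    consider "x \<in> A" "y \<in> A" | "x \<notin> A" "y \<notin> A" | "x \<in> A \<longleftrightarrow> y \<notin> A"
      by blast
    then show ?thesis
    proof cases
      case 1
      then have "card (A - T) \<le> codeg (parity_graph V A) T"
        using xy assms(2) by (intro bound) auto
      moreover have "card (A - T) = card A - 2"
        using 1 xy by (simp add: card_Diff_subset)
      ultimately show ?thesis using assms(4) by simp
    next
      case 2
      then have "card A \<le> codeg (parity_graph V A) T"
        using xy assms(2) by (intro bound) auto
      then show ?thesis using assms(4) by simp
    next
      case 3
      then have "card (V - A - T) \<le> codeg (parity_graph V A) T"
        using xy by (intro bound) auto
      moreover have "(V - A) \<inter> T = (if x \<in> A then {y} else {x})"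
        using 3 xy by auto
      then have "card (V - A - T) = card (V - A) - 1"
        using assms(1) by (subst card_Diff_subset_Int) auto
      ultimately show ?thesis using assms(5) by simp
    qed
  qed
  then show ?thesis
    using assms(1,3) by (simp add: le_min_codeg_iff)
qed

text \<open>The threshold is itself an admissible value, so it must exceed the minimum codegree of
  any \<open>H\<close> without a factor.\<close>

lemma less_factor_threshold:
  fixes H :: "nat hypergraph"
  assumes "three_graph H" "card (verts H) = n" "2 \<le> n" "d \<le> min_codeg H" "\<not> has_factor F H"
  shows "d < factor_threshold n F"
proof -
  let ?P = "\<lambda>d. \<forall>H :: nat hypergraph.
    three_graph H \<and> card (verts H) = n \<and> min_codeg H \<ge> d \<longrightarrow> has_factor F H"
  \<comment> \<open>No codegree exceeds \<open>n\<close>, so \<open>Suc n\<close> is vacuously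
    admissible; this is the witness for \<open>LeastI\<close>.\<close>
  have "\<not> Suc n \<le> min_codeg H'"
    if "three_graph H'" "card (verts H') = n" for H' :: "nat hypergraph"
    using min_codeg_le_card_verts[of H'] that assms(3) by (simp add: three_graph_def)
  then have "?P (Suc n)"
    by blast
  then have "?P (factor_threshold n F)"
    unfolding factor_threshold_def by (rule LeastI)
  then have "\<not> factor_threshold n F \<le> min_codeg H"
    using assms(1,2,5) by blast
  then show ?thesis
    using assms(4) by linarith
qed

theorem proposition1p1:
  fixes n :: nat
  assumes "n > 0" and "4 dvd n"
  shows "real (factor_threshold n K4_minus_e) \<ge> real n / 2 - 1"
proof -
  obtain k where n: "n = 4 * k" and k: "k > 0"
    using assms by auto
  \<comment> \<open>The sizes \<open>2 * k\<close> and \<open>k\<close> agree mod 3 exactly when 3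
    divides \<open>k\<close>; then \<open>2 * k + 1\<close> is 1 mod 3 while \<open>k\<close> is
    0.\<close>
  define a where "a = (if 2 * k mod 3 = k mod 3 then 2 * k + 1 else 2 * k)"
  have a: "a mod 3 \<noteq> k mod 3" "2 * k \<le> a" "a \<le> 2 * k + 1"
    unfolding a_def by presburger+
  let ?H = "parity_graph {..<n} {..<a}"
  have sub: "{..<a} \<subseteq> {..<n}"
    using a k n by auto
  have "\<not> has_factor K4_minus_e ?H"
  proof
    assume "has_factor K4_minus_e ?H"
    then obtain k' where "card {..<n} = 4 * k'" "card {..<a} mod 3 = k' mod 3"
      using parity_graph_factor_imp_cong[OF _ sub] by blast
    then show False
      using a(1) n by simp
  qed
  \<comment> \<open>The bounds \<open>a - 2\<close> and \<open>n - a - 1\<close> are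
    \<open>2 * k - 2\<close> and \<open>2 * k - 1\<close> for \<open>a = 2 * k\<close>, and swap for
    \<open>a = 2 * k + 1\<close>.\<close>
  moreover have "2 * k - 2 \<le> min_codeg ?H"
    using sub a k n by (intro min_codeg_parity_graph) (auto simp: card_Diff_subset)
  ultimately have "2 * k - 2 < factor_threshold n K4_minus_e"
    using k n by (intro less_factor_threshold[of ?H]) (auto simp: three_graph_parity_graph)
  \<comment> \<open>The strict inequality gains one: the threshold is at least
    \<open>2 * k - 1\<close>, which is \<open>n / 2 - 1\<close>.\<close>
  then show ?thesis
    using k n by linarith
qed

end
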